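(* Let $p>2$ be a prime number, let $n\geq0$ be an integer, let $G$ be a finite $p$-group, and let $C_1,\ldots,C_{p-1}$ be normal subgroups of $G$ such that $C_i\subsetneq G$ for all $1\leq i\leq p-1$ and $\displaystyle\max_{g\in G\setminus\left(\bigcup_{i=1}^{p-1}C_i\right)} b(g)\leq n$. Then there exists a normal subgroup $N$ of $G$ such that: (1) $\log_p|G:N|\leq n(n+2)$; (2) $N\not\subseteq\bigcup_{i=1}^{p-1}C_i$; (3) $\displaystyle cl(N)\leq 1+\max_{g\in N\setminus\left(\bigcup_{i=1}^{p-1}C_i\right)} b_N(g)$.
   Context: For $x\in G$, $b(x):=\log_p|G:Z_G(x)|$ where $Z_G(x)$ is the centralizer of $x$ in $G$. For a subgroup $K$ of $G$ and $g\in G$, $b_K(g):=\log_p|K:K\cap Z_G(g)|$. $cl(N)$ denotes the nilpotency class of $N$. *)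

theory Defs
  imports "HOL-Algebra.Algebra"
begin

definition centralizer :: "('a, 'b) monoid_scheme \<Rightarrow> 'a \<Rightarrow> 'a set" where
  "centralizer G x = {g \<in> carrier G. g \<otimes>\<^bsub>G\<^esub> x = x \<otimes>\<^bsub>G\<^esub> g}"

definition bdeg :: "('a, 'b) monoid_scheme \<Rightarrow> nat \<Rightarrow> 'a \<Rightarrow> real" where
  "bdeg G p x = log (real p) (real (card (carrier G)) / real (card (centralizer G x)))"

definition bdeg_sub :: "('a, 'b) monoid_scheme \<Rightarrow> nat \<Rightarrow> 'a set \<Rightarrow> 'a \<Rightarrow> real" where
  "bdeg_sub G p K g = log (real p) (real (card K) / real (card (K \<inter> centralizer G g)))"

text \<open>Lower central series of a subgroup N of G:
  lower_central G N 0 = N = gamma_1(N), lower_central G N (Suc i) = [lower_central G N i, N].\<close>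
fun lower_central :: "('a, 'b) monoid_scheme \<Rightarrow> 'a set \<Rightarrow> nat \<Rightarrow> 'a set" where
  "lower_central G N 0 = N"
| "lower_central G N (Suc i) =
     generate G {a \<otimes>\<^bsub>G\<^esub> b \<otimes>\<^bsub>G\<^esub> inv\<^bsub>G\<^esub> a \<otimes>\<^bsub>G\<^esub> inv\<^bsub>G\<^esub> b | a b. a \<in> lower_central G N i \<and> b \<in> N}"

definition nilpotency_class :: "('a, 'b) monoid_scheme \<Rightarrow> 'a set \<Rightarrow> nat" where
  "nilpotency_class G N = (LEAST c. lower_central G N c = {\<one>\<^bsub>G\<^esub>})"

end

theory Submission
  imports Defs
begin

text \<open>
  Enlarging the \<open>C\<^sub>i\<close> to maximal normal subgroups only weakens the hypothesis on the breadth and only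
  strengthens the conclusion, so each \<open>C\<^sub>i\<close> may be assumed to contain \<open>[G, G]\<close>.

  Consider chains \<open>1 = V\<^sub>0 \<le> \<dots> \<le> V\<^sub>r\<close> of normal subgroups of \<open>G\<close>, contained in all \<open>C\<^sub>i\<close>, with
  \<open>[V\<^sub>j\<^sub>+\<^sub>1, N] \<le> V\<^sub>j\<close> and \<open>[N, N] \<le> V\<^sub>r\<close>, and let \<open>\<beta>\<^sub>j\<close> be the maximal breadth modulo \<open>V\<^sub>j\<close> of the elements of \<open>N\<close>
  outside the \<open>C\<^sub>i\<close>. If \<open>\<beta>\<^sub>0 > \<dots> > \<beta>\<^sub>r\<close>, then \<open>\<beta>\<^sub>0 \<ge> r\<close>, whereas the class of \<open>N\<close> is at most \<open>r + 1\<close>.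
  If \<open>\<beta>\<^sub>j = \<beta>\<^sub>k = b\<close> with \<open>j < k < r\<close>, then \<open>T = C\<^sub>N(V\<^sub>k\<^sub>+\<^sub>1 / V\<^sub>j)\<close> has index at most \<open>p\<^sup>b\<close> in \<open>N\<close> and is
  again not covered by the \<open>C\<^sub>i\<close>; for \<open>T\<close>, the terms between \<open>V\<^sub>j\<close> and \<open>V\<^sub>k\<^sub>+\<^sub>1\<close> may be dropped.
  Collapsing in this way from the bottom, with \<open>k\<close> always maximal, costs at most
  \<open>n + (n - 1) + \<dots> + 1\<close> and leaves a chain with \<open>\<beta>\<^sub>0 + \<dots> + \<beta>\<^sub>r \<le> n (n + 1) / 2\<close>. Any further collapse at
  a repeated value \<open>b\<close> costs \<open>b\<close> and lowers that sum by at least \<open>b\<close>. In total, the index of the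
  resulting \<open>N\<close> is at most \<open>p\<close> to the power \<open>n (n + 1)\<close>.
\<close>

subsection \<open>Commutators and centralizers modulo a normal subgroup\<close>

context group
begin

definition commut :: "'a \<Rightarrow> 'a \<Rightarrow> 'a" where
  "commut a b = a \<otimes> b \<otimes> inv a \<otimes> inv b"

text \<open>For normal \<open>V\<close> this is the preimage in \<open>G\<close> of the centralizer
  of the image of \<open>S\<close> in \<open>G / V\<close>; preimages replace quotient groups
  throughout.\<close>

definition centr :: "'a set \<Rightarrow> 'a set \<Rightarrow> 'a set" where
  "centr V S = {g \<in> carrier G. \<forall>x\<in>S. commut g x \<in> V}"

lemma inv_mult_cancel [simp]:
  assumes "a \<in> carrier G" "b \<in> carrier G"
  shows "a \<otimes> (inv a \<otimes> b) = b" "inv a \<otimes> (a \<otimes> b) = b"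
  using assms by (simp_all flip: m_assoc)

lemma commut_closed [simp, intro]:
  "a \<in> carrier G \<Longrightarrow> b \<in> carrier G \<Longrightarrow> commut a b \<in> carrier G"
  by (simp add: commut_def)

lemma commut_mult_left:
  assumes "g \<in> carrier G" "h \<in> carrier G" "x \<in> carrier G"
  shows "commut (g \<otimes> h) x = (g \<otimes> commut h x \<otimes> inv g) \<otimes> commut g x"
  using assms by (simp add: commut_def m_assoc inv_mult_group)

lemma commut_mult_right:
  assumes "g \<in> carrier G" "x \<in> carrier G" "y \<in> carrier G"
  shows "commut g (x \<otimes> y) = commut g x \<otimes> (x \<otimes> commut g y \<otimes> inv x)"
  using assms by (simp add: commut_def m_assoc inv_mult_group)

lemma commut_inv_left:
  assumes "g \<in> carrier G" "x \<in> carrier G"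
  shows "commut (inv g) x = inv g \<otimes> inv (commut g x) \<otimes> g"
  using assms by (simp add: commut_def m_assoc inv_mult_group)

lemma inv_commut:
  assumes "g \<in> carrier G" "x \<in> carrier G"
  shows "inv (commut g x) = commut x g"
  using assms by (simp add: commut_def m_assoc inv_mult_group)

lemma commut_conj:
  assumes "g \<in> carrier G" "x \<in> carrier G" "k \<in> carrier G"
  shows "commut (k \<otimes> g \<otimes> inv k) x = k \<otimes> commut g (inv k \<otimes> x \<otimes> k) \<otimes> inv k"
  using assms by (simp add: commut_def m_assoc inv_mult_group)

lemma commut_one_left [simp]: "x \<in> carrier G \<Longrightarrow> commut \<one> x = \<one>"
  by (simp add: commut_def)

lemma commut_self [simp]: "x \<in> carrier G \<Longrightarrow> commut x x = \<one>"
  by (simp add: commut_def m_assoc)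

lemma commut_eq_one_iff:
  assumes "g \<in> carrier G" "x \<in> carrier G"
  shows "commut g x = \<one> \<longleftrightarrow> g \<otimes> x = x \<otimes> g"
proof -
  have "commut g x = (g \<otimes> x) \<otimes> inv (x \<otimes> g)"
    using assms by (simp add: commut_def m_assoc inv_mult_group)
  then show ?thesis
    using assms by (metis inv_closed inv_equality inv_inv m_closed r_inv)
qed

lemma normal_conjI: "V \<lhd> G \<Longrightarrow> v \<in> V \<Longrightarrow> g \<in> carrier G \<Longrightarrow> g \<otimes> v \<otimes> inv g \<in> V"
  by (simp add: normal.inv_op_closed2)

lemma normal_conjI': "V \<lhd> G \<Longrightarrow> v \<in> V \<Longrightarrow> g \<in> carrier G \<Longrightarrow> inv g \<otimes> v \<otimes> g \<in> V"
  by (simp add: normal.inv_op_closed1)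

lemma commut_in_normal_left:
  assumes "V \<lhd> G" "v \<in> V" "x \<in> carrier G" shows "commut v x \<in> V"
proof -
  have v: "v \<in> carrier G" using assms by (meson normal_imp_subgroup subgroup.mem_carrier)
  have "commut v x = v \<otimes> (x \<otimes> inv v \<otimes> inv x)"
    using assms v by (simp add: commut_def m_assoc)
  then show ?thesis
    using assms by (simp add: normal_conjI normal_imp_subgroup subgroup.m_closed subgroup.m_inv_closed)
qed

lemma commut_swap_mem:
  assumes "subgroup V G" "g \<in> carrier G" "x \<in> carrier G"
  shows "commut g x \<in> V \<longleftrightarrow> commut x g \<in> V"
  using assms by (metis inv_commut subgroup.m_inv_closed)

lemma subgroup_centr:
  assumes "V \<lhd> G" "S \<subseteq> carrier G"
  shows "subgroup (centr V S) G"
proof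
  note sV = normal_imp_subgroup[OF assms(1)]
  show "centr V S \<subseteq> carrier G" by (auto simp: centr_def)
  show "\<one> \<in> centr V S"
    using assms sV by (auto simp: centr_def subgroup.one_closed subset_iff)
  fix g assume g: "g \<in> centr V S"
  then have gc: "g \<in> carrier G" by (simp add: centr_def)
  have "commut (inv g) x \<in> V" if "x \<in> S" for x
  proof -
    have "inv g \<otimes> inv (commut g x) \<otimes> g \<in> V"
      using that g gc by (intro normal_conjI'[OF assms(1)] subgroup.m_inv_closed[OF sV]) (simp_all add: centr_def)
    then show ?thesis using that gc assms(2) by (simp add: commut_inv_left subset_iff)
  qed
  then show "inv g \<in> centr V S" using gc by (simp add: centr_def)
  fix h assume h: "h \<in> centr V S"
  then have hc: "h \<in> carrier G" by (simp add: centr_def)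
  have "commut (g \<otimes> h) x \<in> V" if "x \<in> S" for x
  proof -
    have "(g \<otimes> commut h x \<otimes> inv g) \<otimes> commut g x \<in> V"
      using that g h gc by (intro subgroup.m_closed[OF sV] normal_conjI[OF assms(1)]) (simp_all add: centr_def)
    then show ?thesis using that gc hc assms(2) by (simp add: commut_mult_left subset_iff)
  qed
  then show "g \<otimes> h \<in> centr V S" using gc hc by (simp add: centr_def)
qed

text \<open>Conjugating \<open>g\<close> by \<open>k\<close> amounts to testing \<open>g\<close>
  against \<open>inv k \<otimes> x \<otimes> k\<close> instead of \<open>x\<close>, see
  \<open>commut_conj\<close>.\<close>

lemma normal_centr:
  assumes V: "V \<lhd> G" and S: "S \<subseteq> carrier G"
    and inv_conj: "\<And>x k. x \<in> S \<Longrightarrow> k \<in> carrier G \<Longrightarrow> inv k \<otimes> x \<otimes> k \<in> S"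
  shows "centr V S \<lhd> G"
  unfolding normal_inv_iff
proof (intro conjI ballI)
  show "subgroup (centr V S) G" using V S by (rule subgroup_centr)
  fix k g assume k: "k \<in> carrier G" and g: "g \<in> centr V S"
  then have gc: "g \<in> carrier G" by (simp add: centr_def)
  have "commut (k \<otimes> g \<otimes> inv k) x \<in> V" if "x \<in> S" for x
  proof -
    have "commut g (inv k \<otimes> x \<otimes> k) \<in> V" using g inv_conj[OF that k] by (simp add: centr_def)
    then show ?thesis
      using commut_conj[of g x k] gc k that S V by (auto simp: subset_iff intro!: normal_conjI)
  qed
  then show "k \<otimes> g \<otimes> inv k \<in> centr V S" using gc k by (simp add: centr_def)
qed

lemma centr_normal:
  assumes "V \<lhd> G" "S \<lhd> G"
  shows "centr V S \<lhd> G"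
  using assms by (intro normal_centr) (simp_all add: normal_imp_subgroup subgroup.subset normal_conjI')

text \<open>The multiplication map from \<open>A \<times> B\<close> to \<open>K\<close> has fibres
  of size at most \<open>card (A \<inter> B)\<close>.\<close>

lemma card_subgroup_Int:
  assumes fin: "finite (carrier G)" and A: "subgroup A G" and B: "subgroup B G" and K: "subgroup K G"
    and AK: "A \<subseteq> K" and BK: "B \<subseteq> K"
  shows "card A * card B \<le> card K * card (A \<inter> B)"
proof -
  have fA: "finite A" and fB: "finite B" and fK: "finite K"
    using fin A B K by (auto intro: finite_subset dest: subgroup.subset)
  let ?f = "\<lambda>(a, b). a \<otimes> b"
  have img: "?f ` (A \<times> B) \<subseteq> K"
    using AK BK subgroup.m_closed[OF K] by auto
  have fib: "card {z \<in> A \<times> B. ?f z = c} \<le> card (A \<inter> B)" if "c \<in> ?f ` (A \<times> B)" for c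
  proof -
    from that obtain a b where ab: "a \<in> A" "b \<in> B" "c = a \<otimes> b" by auto
    have ca: "a \<in> carrier G" "b \<in> carrier G" using ab A B by (auto simp: subgroup.mem_carrier)
    \<comment> \<open>Any two factorizations of \<open>c\<close> differ by shifting an element
      \<open>d\<close> of \<open>A \<inter> B\<close> from one factor to the other.\<close>
    let ?g = "\<lambda>d. (a \<otimes> d, inv d \<otimes> b)"
    have "{z \<in> A \<times> B. ?f z = c} \<subseteq> ?g ` (A \<inter> B)"
    proof
      fix z assume "z \<in> {z \<in> A \<times> B. ?f z = c}"
      then obtain x y where xy: "z = (x, y)" "x \<in> A" "y \<in> B" "x \<otimes> y = c" by (cases z) auto
      have cx: "x \<in> carrier G" "y \<in> carrier G" using xy A B by (auto simp: subgroup.mem_carrier)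
      define d where "d = inv a \<otimes> x"
      have dA: "d \<in> A" using d_def xy ab A by (simp add: subgroup.m_closed subgroup.m_inv_closed)
      have "d \<otimes> y = b" using xy ab ca cx by (simp add: d_def m_assoc)
      then have d: "d = b \<otimes> inv y"
        using ca cx by (simp add: d_def inv_solve_right)
      then have dB: "d \<in> B" using xy ab B by (simp add: subgroup.m_closed subgroup.m_inv_closed)
      have "inv d \<otimes> b = y" using ca cx by (simp add: d m_assoc inv_mult_group)
      moreover have "a \<otimes> d = x" using ca cx by (simp add: d_def)
      ultimately show "z \<in> ?g ` (A \<inter> B)" using dA dB xy(1) by (intro image_eqI[of _ _ d]) auto
    qed
    then show ?thesis using fA by (meson finite_Int surj_card_le)
  qed
  have "card A * card B = card (A \<times> B)" by (simp add: card_cartesian_product)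
  also have "\<dots> = (\<Sum>c\<in>?f ` (A \<times> B). card {z \<in> A \<times> B. ?f z = c})"
  proof -
    have eq: "(\<Union>c\<in>?f ` (A \<times> B). {z \<in> A \<times> B. ?f z = c}) = A \<times> B" by blast
    have "card (\<Union>c\<in>?f ` (A \<times> B). {z \<in> A \<times> B. ?f z = c}) = (\<Sum>c\<in>?f ` (A \<times> B). card {z \<in> A \<times> B. ?f z = c})"
      using fA fB by (intro card_UN_disjoint) auto
    then show ?thesis unfolding eq .
  qed
  also have "\<dots> \<le> (\<Sum>c\<in>?f ` (A \<times> B). card (A \<inter> B))" using fib by (intro sum_mono) auto
  also have "\<dots> = card (?f ` (A \<times> B)) * card (A \<inter> B)" by simp
  also have "\<dots> \<le> card K * card (A \<inter> B)"
    using img fK by (intro mult_right_mono card_mono) auto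
  finally show ?thesis .
qed

lemma card_subgroup_dvd:
  assumes A: "subgroup A G" and K: "subgroup K G" and AK: "A \<subseteq> K"
  shows "card A dvd card K"
proof -
  interpret K: group "G\<lparr>carrier := K\<rparr>" using K by (rule subgroup_imp_group)
  have "subgroup A (G\<lparr>carrier := K\<rparr>)" using assms by (simp add: subgroup_incl)
  from K.lagrange[OF this] have "card (rcosets\<^bsub>G\<lparr>carrier := K\<rparr>\<^esub> A) * card A = card K"
    by (simp add: order_def)
  then show ?thesis by (metis dvd_triv_right)
qed

end

subsection \<open>Finite p-groups\<close>

locale finite_p_group = group +
  fixes p :: nat
  assumes prime_p: "Factorial_Ring.prime p" and fin: "finite (carrier G)"
    and card_carrier: "\<exists>k. card (carrier G) = p ^ k"
begin

text \<open>A logarithm to base \<open>p\<close> in the natural numbers, exact on subgroups by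
  \<open>card_subgroup\<close>.\<close>

definition lg_card :: "'a set \<Rightarrow> nat" where
  "lg_card A = multiplicity p (card A)"

lemma p_gt_1: "p > 1" using prime_p by (rule prime_gt_1_nat)

lemma finite_subgroup: "subgroup A G \<Longrightarrow> finite A"
  using fin by (meson finite_subset subgroup.subset)

lemma card_subgroup:
  assumes "subgroup A G" shows "card A = p ^ lg_card A"
proof -
  obtain k where "card (carrier G) = p ^ k" using card_carrier by blast
  moreover have "card A dvd card (carrier G)"
    using assms by (intro card_subgroup_dvd subgroup_self subgroup.subset)
  ultimately obtain i where "card A = p ^ i"
    using prime_p by (auto simp: divides_primepow_nat)
  then show ?thesis using prime_p by (simp add: lg_card_def multiplicity_prime_power)
qed

lemma lg_card_mono:
  assumes "subgroup A G" "subgroup B G" "A \<subseteq> B" shows "lg_card A \<le> lg_card B"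
proof -
  have "card A \<le> card B" using assms by (simp add: card_mono finite_subgroup)
  then show ?thesis using assms p_gt_1 by (simp add: card_subgroup)
qed

lemma lg_card_eqD:
  assumes "subgroup A G" "subgroup B G" "A \<subseteq> B" "lg_card B \<le> lg_card A" shows "A = B"
proof -
  have "card B \<le> card A" using assms p_gt_1 by (simp add: card_subgroup)
  then show ?thesis using assms by (simp add: card_seteq finite_subgroup)
qed

lemma lg_card_Int:
  assumes "subgroup A G" "subgroup B G" "subgroup K G" "A \<subseteq> K" "B \<subseteq> K"
  shows "lg_card A + lg_card B \<le> lg_card K + lg_card (A \<inter> B)"
proof -
  have "subgroup (A \<inter> B) G" using assms by (simp add: subgroups_Inter_pair)
  then have "p ^ (lg_card A + lg_card B) \<le> p ^ (lg_card K + lg_card (A \<inter> B))"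
    using card_subgroup_Int[OF fin assms(1,2,3,4,5)] assms by (simp add: card_subgroup power_add)
  then show ?thesis using p_gt_1 by simp
qed

text \<open>Each \<open>S j\<close> has at most \<open>card N / p\<close> elements, and all of them
  share \<open>\<one>\<close>, so not even \<open>p\<close> of them can fill
  \<open>N\<close>.\<close>

lemma not_covered:
  assumes N: "subgroup N G" and J: "finite J" "card J \<le> p"
    and S: "\<And>j. j \<in> J \<Longrightarrow> subgroup (S j) G" "\<And>j. j \<in> J \<Longrightarrow> S j \<subset> N"
  shows "\<exists>x\<in>N. \<forall>j\<in>J. x \<notin> S j"
proof (rule ccontr)
  assume contra: "\<not> ?thesis"
  \<comment> \<open>Removing the shared identity makes the count strict enough for exactly
    \<open>p\<close> subgroups.\<close>
  then have cov: "N - {\<one>} \<subseteq> (\<Union>j\<in>J. S j - {\<one>})" by blast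
  have cN: "card N > 0" using N by (metis card_gt_0_iff empty_iff finite_subgroup subgroup.one_closed)
  have le: "p * (card (S j - {\<one>}) + 1) \<le> card N" if "j \<in> J" for j
  proof -
    have "lg_card (S j) < lg_card N"
      using S[OF that] N lg_card_eqD[of "S j" N] by (metis linorder_not_le psubset_eq)
    then have "p * p ^ lg_card (S j) \<le> p ^ lg_card N"
      using p_gt_1 by (metis Suc_leI one_less_power power_Suc power_increasing less_imp_le)
    moreover have "card (S j - {\<one>}) + 1 = card (S j)"
      using S[OF that] finite_subgroup subgroup.one_closed
      by (metis Suc_eq_plus1 card_Suc_Diff1)
    ultimately show ?thesis using S[OF that] N by (simp add: card_subgroup)
  qed
  have "finite (\<Union>j\<in>J. S j - {\<one>})" using J S by (auto simp: finite_subgroup)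
  then have "card (N - {\<one>}) \<le> card (\<Union>j\<in>J. S j - {\<one>})" using cov by (rule card_mono)
  also have "\<dots> \<le> (\<Sum>j\<in>J. card (S j - {\<one>}))" using J by (intro card_UN_le)
  finally have le2: "card (N - {\<one>}) \<le> (\<Sum>j\<in>J. card (S j - {\<one>}))" .
  have "p * (card (N - {\<one>})) + p * card J \<le> (\<Sum>j\<in>J. p * (card (S j - {\<one>}) + 1))"
    using mult_le_mono2[OF le2, of p] by (simp add: sum.distrib sum_distrib_left algebra_simps)
  also have "\<dots> \<le> (\<Sum>j\<in>J. card N)" using le by (rule sum_mono)
  also have "\<dots> = card J * card N" by simp
  finally have A: "p * card (N - {\<one>}) + p * card J \<le> card J * card N" .
  have "card N = card (N - {\<one>}) + 1"
    using N finite_subgroup subgroup.one_closed by (metis Suc_eq_plus1 card_Suc_Diff1)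
  then obtain m where m: "card N = m + 1" "card (N - {\<one>}) = m" by blast
  have "card J * m \<le> p * m" using J by simp
  then have "p * card J \<le> card J" using A unfolding m by (simp only: distrib_left mult_1_right)
  then have "card J = 0" using p_gt_1 by auto
  then have "J = {}" using J by simp
  then show False using contra N subgroup.one_closed by blast
qed

text \<open>The conjugation action of \<open>G\<close> on \<open>V / M\<close> fixes the trivial coset, hence, both \<open>|G|\<close> and
  \<open>|V / M|\<close> being powers of \<open>p\<close>, also another one.\<close>
lemma ex_central_modulo:
  assumes M: "M \<lhd> G" and V: "V \<lhd> G" and MV: "M \<subset> V"
  shows "\<exists>v\<in>V - M. \<forall>g\<in>carrier G. commut v g \<in> M"
proof (rule ccontr)
  assume contra: "\<not> ?thesis"
  let ?E = "{H. H \<subseteq> carrier G}" and ?\<phi> = "\<lambda>g. \<lambda>H \<in> {H. H \<subseteq> carrier G}. g <# H #> inv g"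
  interpret act: group_action G ?E ?\<phi> by (rule action_by_conjugation_on_power_set)
  note sM = normal_imp_subgroup[OF M] and sV = normal_imp_subgroup[OF V]
  have Mc: "M \<subseteq> carrier G" and Vc: "V \<subseteq> carrier G" using sM sV by (auto dest: subgroup.subset)
  \<comment> \<open>The nontrivial cosets of \<open>M\<close> in \<open>V\<close>; the aim is that
    all conjugation orbits on them have size divisible by \<open>p\<close>.\<close>
  define S where "S = (\<lambda>v. M #> v) ` (V - M)"
  have cos: "g <# (M #> v) #> inv g = M #> (g \<otimes> v \<otimes> inv g)" if "g \<in> carrier G" "v \<in> carrier G" for g v
  proof -
    have "g <# (M #> v) #> inv g = (g <# M) #> v #> inv g"
      using that Mc by (simp add: coset_assoc)
    also have "\<dots> = M #> g #> v #> inv g" using normal.coset_eq[OF M] that by simp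
    finally show ?thesis using that Mc by (simp add: coset_mult_assoc m_assoc)
  qed
  have SE: "M #> v \<in> ?E" if "v \<in> carrier G" for v using that Mc r_coset_subset_G by auto
  have orb: "orbit G ?\<phi> (M #> v) = (\<lambda>g. M #> (g \<otimes> v \<otimes> inv g)) ` carrier G" if "v \<in> carrier G" for v
    using that SE[OF that] by (auto simp: orbit_def image_def) (metis cos)+
  have orbS: "orbit G ?\<phi> (M #> v) \<subseteq> S" if "v \<in> V - M" for v
  proof -
    have vc: "v \<in> carrier G" using that Vc by blast
    have "g \<otimes> v \<otimes> inv g \<in> V - M" if "g \<in> carrier G" for g
    proof -
      have "g \<otimes> v \<otimes> inv g \<in> V" using V \<open>v \<in> V - M\<close> that by (simp add: normal_conjI)
      moreover have "v \<in> M" if "g \<otimes> v \<otimes> inv g \<in> M"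
        using normal_conjI'[OF M that \<open>g \<in> carrier G\<close>] vc \<open>g \<in> carrier G\<close> by (simp add: m_assoc)
      ultimately show ?thesis using \<open>v \<in> V - M\<close> by blast
    qed
    then show ?thesis using vc by (auto simp: orb S_def)
  qed
  have orb_dvd: "p dvd card (orbit G ?\<phi> (M #> v))" if v: "v \<in> V - M" for v
  proof -
    have vc: "v \<in> carrier G" using v Vc by blast
    obtain k where k: "card (carrier G) = p ^ k" using card_carrier by blast
    have "card (orbit G ?\<phi> (M #> v)) dvd p ^ k"
      unfolding k[symmetric] order_def[symmetric]
        act.orbit_stabilizer_theorem[OF SE[OF vc], symmetric] by (rule dvd_triv_left)
    then obtain i where i: "card (orbit G ?\<phi> (M #> v)) = p ^ i"
      using prime_p by (auto simp: divides_primepow_nat)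
    \<comment> \<open>A one-element orbit would yield an element outside \<open>M\<close> that is
      central modulo \<open>M\<close>.\<close>
    have "i \<noteq> 0"
    proof
      assume "i = 0"
      then have "card (orbit G ?\<phi> (M #> v)) = 1" using i by simp
      then obtain B where B: "orbit G ?\<phi> (M #> v) = {B}" by (auto simp: card_1_singleton_iff)
      have "M #> v \<in> orbit G ?\<phi> (M #> v)" using act.orbit_refl[OF SE[OF vc]] .
      then have B: "orbit G ?\<phi> (M #> v) = {M #> v}" using B by simp
      have "commut v g \<in> M" if g: "g \<in> carrier G" for g
      proof -
        have "M #> (g \<otimes> v \<otimes> inv g) = M #> v" using B orb[OF vc] g by blast
        then have "g \<otimes> v \<otimes> inv g \<in> M #> v"
          using g vc sM by (metis inv_closed m_closed rcos_self)
        then obtain m where m: "m \<in> M" "g \<otimes> v \<otimes> inv g = m \<otimes> v" by (auto simp: r_coset_def)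
        have "m \<in> carrier G" using m Mc by blast
        then have "commut g v = m" using m g vc by (simp add: commut_def m_assoc flip: inv_mult_group)
        then show ?thesis using commut_swap_mem[OF sM g vc] m by simp
      qed
      then show False using contra v by blast
    qed
    then show ?thesis using i by simp
  qed
  have finV: "finite V" using sV by (rule finite_subgroup)
  have finS: "finite S" using finV by (simp add: S_def)
  have US: "\<Union> (orbit G ?\<phi> ` S) = S"
  proof
    show "S \<subseteq> \<Union> (orbit G ?\<phi> ` S)"
    proof
      fix B assume "B \<in> S"
      moreover from this have "B \<in> ?E" using SE Vc by (auto simp: S_def)
      ultimately show "B \<in> \<Union> (orbit G ?\<phi> ` S)" using act.orbit_refl by blast
    qed
    show "\<Union> (orbit G ?\<phi> ` S) \<subseteq> S" using orbS by (auto simp: S_def)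
  qed
  have "p dvd card (\<Union> (orbit G ?\<phi> ` S))"
  proof (rule dvd_partition)
    show "finite (\<Union> (orbit G ?\<phi> ` S))" unfolding US by (rule finS)
    show "\<forall>c\<in>orbit G ?\<phi> ` S. p dvd card c" using orb_dvd by (auto simp: S_def)
    have "orbit G ?\<phi> ` S \<subseteq> orbits G ?E ?\<phi>"
      using SE Vc by (auto simp: orbits_def S_def)
    then show "\<forall>c1\<in>orbit G ?\<phi> ` S. \<forall>c2\<in>orbit G ?\<phi> ` S. c1 \<noteq> c2 \<longrightarrow> c1 \<inter> c2 = {}"
      using act.disjoint_union by blast
  qed
  then have dS: "p dvd card S" unfolding US .
  have UN: "V - M = \<Union> S"
  proof
    show "V - M \<subseteq> \<Union> S"
    proof
      fix v assume v: "v \<in> V - M"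
      then have "v \<in> M #> v" using sM Vc by (meson DiffD1 rcos_self subsetD)
      then show "v \<in> \<Union> S" using v by (auto simp: S_def)
    qed
    show "\<Union> S \<subseteq> V - M"
    proof clarify
      fix u B assume "u \<in> B" "B \<in> S"
      then obtain v m where v: "v \<in> V - M" "m \<in> M" "u = m \<otimes> v" by (auto simp: S_def r_coset_def)
      then have c: "m \<in> carrier G" "v \<in> carrier G" using Mc Vc by auto
      have "u \<in> V" using v MV sV by (auto intro: subgroup.m_closed)
      moreover have "v \<in> M" if "u \<in> M"
      proof -
        have "inv m \<otimes> u \<in> M" using that v sM by (simp add: subgroup.m_closed subgroup.m_inv_closed)
        then show ?thesis using v c by simp
      qed
      ultimately show "u \<in> V - M" using v by blast
    qed
  qed
  have "card M * card S = card (\<Union> S)"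
  proof (rule card_partition)
    show "finite S" "finite (\<Union> S)" using finV UN by (auto simp: S_def)
    have "S \<subseteq> rcosets M" using Vc by (auto simp: S_def RCOSETS_def)
    then show "\<And>c. c \<in> S \<Longrightarrow> card c = card M" "\<And>c1 c2. c1 \<in> S \<Longrightarrow> c2 \<in> S \<Longrightarrow> c1 \<noteq> c2 \<Longrightarrow> c1 \<inter> c2 = {}"
      using card_rcosets_equal[OF _ Mc] rcos_disjoint[OF sM] unfolding pairwise_def disjnt_def by (metis subsetD)+
  qed
  \<comment> \<open>Since \<open>p * card M\<close> also divides \<open>card V\<close>, it would
    divide the difference \<open>card M\<close>, which is absurd.\<close>
  then have "p * card M dvd card (V - M)" using dS UN by (metis mult.commute mult_dvd_mono dvd_refl)
  moreover have "p * card M dvd card V"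
  proof -
    have "lg_card M < lg_card V" using sM sV MV lg_card_eqD[of M V] by (metis linorder_not_le psubset_eq)
    then have "p ^ Suc (lg_card M) dvd p ^ lg_card V" by (intro le_imp_power_dvd) simp
    then show ?thesis using sM sV by (simp add: card_subgroup)
  qed
  moreover have "card V = card (V - M) + card M"
    using MV finV by (metis card_Diff_subset card_mono finite_subset le_add_diff_inverse2 psubset_imp_subset)
  ultimately have "p * card M dvd card M" by (metis dvd_add_right_iff)
  moreover have "card M > 0" using sM p_gt_1 by (simp add: card_subgroup)
  ultimately show False using p_gt_1 by (simp add: dvd_mult_cancel2)
qed

text \<open>Take \<open>M\<close> maximal among the proper normal subgroups containing
  \<open>A\<close>. The preimage of the centre of \<open>G / M\<close> is normal and strictly larger
  by \<open>ex_central_modulo\<close>, hence all of \<open>G\<close>.\<close>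

lemma ex_normal_commut:
  assumes "A \<lhd> G" "A \<noteq> carrier G"
  shows "\<exists>M. M \<lhd> G \<and> M \<noteq> carrier G \<and> A \<subseteq> M \<and> (\<forall>a\<in>carrier G. \<forall>b\<in>carrier G. commut a b \<in> M)"
proof -
  let ?F = "{M. M \<lhd> G \<and> M \<noteq> carrier G \<and> A \<subseteq> M}"
  have sub: "M \<subseteq> carrier G" if "M \<lhd> G" for M
    using that by (simp add: normal_imp_subgroup subgroup.subset)
  have "?F \<subseteq> Pow (carrier G)" using sub by auto
  then have "finite ?F" using fin by (meson finite_Pow_iff finite_subset)
  moreover have "?F \<noteq> {}" using assms by auto
  ultimately obtain M where M: "M \<in> ?F" and max: "\<And>K. K \<in> ?F \<Longrightarrow> M \<subseteq> K \<Longrightarrow> M = K"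
    using finite_has_maximal[of ?F] by auto
  let ?W = "centr M (carrier G)"
  have W: "?W \<lhd> G" using M normal_self by (auto intro: centr_normal)
  have MW: "M \<subseteq> ?W" using M sub commut_in_normal_left by (auto simp: centr_def)
  have "\<exists>v\<in>carrier G - M. \<forall>g\<in>carrier G. commut v g \<in> M"
    using M sub normal_self by (intro ex_central_modulo) auto
  then have "?W \<noteq> M" by (auto simp: centr_def)
  then have "?W = carrier G" using max[of ?W] M W MW by auto
  then have "\<forall>a\<in>carrier G. \<forall>b\<in>carrier G. commut a b \<in> M" by (auto simp: centr_def)
  then show ?thesis using M by blast
qed

section \<open>Breadth modulo a normal subgroup\<close>

definition breadth :: "'a set \<Rightarrow> 'a set \<Rightarrow> 'a \<Rightarrow> nat" where
  "breadth N V x = lg_card N - lg_card (N \<inter> centr V {x})"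

lemma subgroup_Int_centr:
  assumes "subgroup N G" "V \<lhd> G" "x \<in> carrier G"
  shows "subgroup (N \<inter> centr V {x}) G"
  using assms by (intro subgroups_Inter_pair subgroup_centr) auto

text \<open>Shows that the truncated subtraction in \<open>breadth\<close> is exact.\<close>

lemma lg_card_Int_centr:
  assumes "subgroup N G" "V \<lhd> G" "x \<in> carrier G"
  shows "lg_card N = lg_card (N \<inter> centr V {x}) + breadth N V x"
  using lg_card_mono[OF subgroup_Int_centr[OF assms] assms(1)] by (simp add: breadth_def)

lemma centr_mono: "V \<subseteq> U \<Longrightarrow> centr V S \<subseteq> centr U S"
  by (auto simp: centr_def)

lemma breadth_antimono:
  assumes "subgroup N G" "V \<lhd> G" "U \<lhd> G" "V \<subseteq> U" "x \<in> carrier G"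
  shows "breadth N U x \<le> breadth N V x"
  using assms centr_mono[of V U "{x}"] unfolding breadth_def
  by (intro diff_le_mono2 lg_card_mono subgroup_Int_centr) auto

text \<open>The index of a subgroup of \<open>N\<close> does not grow when both are intersected with
  \<open>M\<close>; this is \<open>lg_card_Int\<close> for \<open>M\<close> and the centralizer in
  \<open>N\<close>.\<close>

lemma breadth_mono:
  assumes "subgroup M G" "subgroup N G" "M \<subseteq> N" "V \<lhd> G" "x \<in> carrier G"
  shows "breadth M V x \<le> breadth N V x"
proof -
  have "lg_card M + lg_card (N \<inter> centr V {x}) \<le> lg_card N + lg_card (M \<inter> (N \<inter> centr V {x}))"
    using assms by (intro lg_card_Int subgroup_Int_centr) auto
  moreover have "M \<inter> (N \<inter> centr V {x}) = M \<inter> centr V {x}" using assms by auto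
  ultimately show ?thesis by (simp add: breadth_def)
qed

text \<open>Translates the real logarithm of the statement into \<open>breadth\<close> modulo the
  trivial subgroup.\<close>

lemma bdeg_sub_eq_breadth:
  assumes "subgroup N G" "x \<in> carrier G"
  shows "bdeg_sub G p N x = real (breadth N {\<one>} x)"
proof -
  let ?H = "N \<inter> centr {\<one>} {x}"
  have eq: "N \<inter> centralizer G x = ?H"
    using assms by (auto simp: centralizer_def centr_def commut_eq_one_iff subgroup.mem_carrier)
  have sH: "subgroup ?H G" using assms by (intro subgroup_Int_centr one_is_normal)
  have "bdeg_sub G p N x = log (real p) (real p ^ lg_card N / real p ^ lg_card ?H)"
    unfolding bdeg_sub_def eq by (simp add: card_subgroup[OF sH] card_subgroup[OF assms(1)])
  also have "real p ^ lg_card N / real p ^ lg_card ?H = real p ^ breadth N {\<one>} x"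
    using p_gt_1 lg_card_Int_centr[OF assms(1) one_is_normal assms(2)] by (simp add: power_add)
  also have "log (real p) \<dots> = real (breadth N {\<one>} x)"
    using p_gt_1 by simp
  finally show ?thesis .
qed

end

subsection \<open>Breadth away from a family of normal subgroups\<close>

text \<open>The strict bound on \<open>card I\<close> leaves room for one further subgroup in
  \<open>not_covered\<close>. Assumption \<open>commut_in_C\<close> puts all commutators into
  \<open>common\<close>, where central chains can end.\<close>

locale p_group_avoiding = finite_p_group +
  fixes I :: "'i set" and C :: "'i \<Rightarrow> 'a set"
  assumes finite_I: "finite I" and card_I: "card I < p"
    and normal_C: "i \<in> I \<Longrightarrow> C i \<lhd> G"
    and C_proper: "i \<in> I \<Longrightarrow> C i \<noteq> carrier G"
    and commut_in_C: "i \<in> I \<Longrightarrow> a \<in> carrier G \<Longrightarrow> b \<in> carrier G \<Longrightarrow> commut a b \<in> C i"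
begin

definition avoid :: "'a set \<Rightarrow> 'a set" where
  "avoid N = N - (\<Union>i\<in>I. C i)"

definition admissible :: "'a set \<Rightarrow> bool" where
  "admissible N \<longleftrightarrow> N \<lhd> G \<and> avoid N \<noteq> {}"

text \<open>The intersection of the \<open>C i\<close>, with value \<open>carrier G\<close> for
  empty \<open>I\<close>. Multiplying by its elements does not change whether an element lies in
  some \<open>C i\<close>.\<close>

definition common :: "'a set" where
  "common = {x \<in> carrier G. \<forall>i\<in>I. x \<in> C i}"

text \<open>Meaningful for admissible \<open>N\<close>, where the maximum is over a finite nonempty
  set.\<close>

definition max_breadth :: "'a set \<Rightarrow> 'a set \<Rightarrow> nat" where
  "max_breadth N V = Max (breadth N V ` avoid N)"

text \<open>Intersecting \<open>W\<close> with \<open>N\<close> lets the terms of a chain stay the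
  same while \<open>N\<close> shrinks.\<close>

definition centralizes :: "'a set \<Rightarrow> 'a set \<Rightarrow> 'a set \<Rightarrow> bool" where
  "centralizes N W V \<longleftrightarrow> (\<forall>w\<in>W \<inter> N. \<forall>g\<in>N. commut w g \<in> V)"

lemma admissibleD: "admissible N \<Longrightarrow> N \<lhd> G" "admissible N \<Longrightarrow> subgroup N G" "admissible N \<Longrightarrow> N \<subseteq> carrier G"
  by (auto simp: admissible_def normal_imp_subgroup dest: subgroup.subset[OF normal_imp_subgroup])

lemma avoid_subset: "avoid N \<subseteq> N"
  by (auto simp: avoid_def)

lemma breadth_le_max_breadth:
  assumes "admissible N" "x \<in> avoid N" shows "breadth N V x \<le> max_breadth N V"
  using assms finite_subgroup[OF admissibleD(2)] by (auto simp: max_breadth_def avoid_def intro!: Max_ge)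

lemma max_breadth_attained:
  assumes "admissible N" obtains x where "x \<in> avoid N" "breadth N V x = max_breadth N V"
proof -
  have "finite (breadth N V ` avoid N)" "breadth N V ` avoid N \<noteq> {}"
    using assms finite_subgroup[OF admissibleD(2)] by (auto simp: admissible_def avoid_def)
  then have "max_breadth N V \<in> breadth N V ` avoid N" unfolding max_breadth_def by (rule Max_in)
  then show ?thesis using that by auto
qed

lemma max_breadth_antimono:
  assumes "admissible N" "V \<lhd> G" "U \<lhd> G" "V \<subseteq> U"
  shows "max_breadth N U \<le> max_breadth N V"
proof -
  obtain x where x: "x \<in> avoid N" "breadth N U x = max_breadth N U" using max_breadth_attained[OF assms(1)] .
  then have "breadth N U x \<le> breadth N V x"
    using assms admissibleD[OF assms(1)] avoid_subset[of N] by (intro breadth_antimono) auto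
  then show ?thesis using breadth_le_max_breadth[OF assms(1) x(1), of V] x(2) by linarith
qed

lemma max_breadth_mono:
  assumes "admissible M" "admissible N" "M \<subseteq> N" "V \<lhd> G"
  shows "max_breadth M V \<le> max_breadth N V"
proof -
  obtain x where x: "x \<in> avoid M" "breadth M V x = max_breadth M V" using max_breadth_attained[OF assms(1)] .
  then have "breadth M V x \<le> breadth N V x"
    using assms admissibleD[OF assms(1)] admissibleD[OF assms(2)] avoid_subset[of M] by (intro breadth_mono) auto
  moreover have "x \<in> avoid N" using x(1) assms(3) by (auto simp: avoid_def)
  ultimately show ?thesis using breadth_le_max_breadth[OF assms(2), of x V] x(2) by linarith
qed

lemma centralizes_mono:
  "centralizes N W V \<Longrightarrow> M \<subseteq> N \<Longrightarrow> centralizes M W V"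
  by (auto simp: centralizes_def)

lemma max_breadth_eq_0:
  assumes N: "admissible N" and V: "V \<lhd> G" and ab: "\<And>a b. a \<in> N \<Longrightarrow> b \<in> N \<Longrightarrow> commut a b \<in> V"
  shows "max_breadth N V = 0"
proof -
  obtain x where x: "x \<in> avoid N" "breadth N V x = max_breadth N V" using max_breadth_attained[OF N] .
  have "N \<inter> centr V {x} = N" using x ab admissibleD(3)[OF N] avoid_subset[of N] by (auto simp: centr_def)
  then show ?thesis using x by (simp add: breadth_def)
qed

text \<open>If \<open>N\<close> were not abelian modulo \<open>V\<close>, its centre modulo
  \<open>V\<close> and the fewer than \<open>p\<close> subgroups \<open>N \<inter> C i\<close> would
  all be proper. By \<open>not_covered\<close> some element avoids them all; it is noncentral, so
  its breadth is positive.\<close>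

lemma commut_mem_if_max_breadth_eq_0:
  assumes N: "admissible N" and V: "V \<lhd> G" and 0: "max_breadth N V = 0" and ab: "a \<in> N" "b \<in> N"
  shows "commut a b \<in> V"
proof (rule ccontr)
  assume ncmt: "commut a b \<notin> V"
  note sN = admissibleD(2)[OF N] and Nc = admissibleD(3)[OF N] and sV = normal_imp_subgroup[OF V]
  let ?Z = "N \<inter> centr V N"
  have sZ: "subgroup ?Z G" using sN Nc V by (intro subgroups_Inter_pair subgroup_centr)
  have Z: "?Z \<subset> N" using ncmt ab by (auto simp: centr_def)
  obtain y where y: "y \<in> avoid N" using N by (auto simp: admissible_def)
  \<comment> \<open>\<open>None\<close> indexes the centre modulo \<open>V\<close>, and
    \<open>Some i\<close> indexes \<open>N \<inter> C i\<close>.\<close>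
  let ?J = "insert None (Some ` I)"
  let ?S = "case_option ?Z (\<lambda>i. N \<inter> C i)"
  have "\<exists>x\<in>N. \<forall>j\<in>?J. x \<notin> ?S j"
  proof (rule not_covered[OF sN])
    show "finite ?J" using finite_I by simp
    show "card ?J \<le> p" using finite_I card_I by (simp add: card_image card_insert_if)
    fix j assume j: "j \<in> ?J"
    then show "subgroup (?S j) G"
      using sZ by (auto intro!: subgroups_Inter_pair sN normal_imp_subgroup[OF normal_C])
    show "?S j \<subset> N"
    proof (cases j)
      case None
      then show ?thesis using Z by simp
    next
      case (Some i)
      then have "y \<in> N - C i" using j y by (auto simp: avoid_def)
      then show ?thesis using Some by auto
    qed
  qed
  then obtain x where x: "x \<in> N" "x \<notin> ?Z" "\<And>i. i \<in> I \<Longrightarrow> x \<notin> C i" by auto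
  then have xa: "x \<in> avoid N" by (auto simp: avoid_def)
  have xc: "x \<in> carrier G" using x Nc by auto
  have "breadth N V x = 0" using breadth_le_max_breadth[OF N xa, of V] 0 by simp
  then have "N \<inter> centr V {x} = N"
    using lg_card_Int_centr[OF sN V xc] sN V xc by (intro lg_card_eqD subgroup_Int_centr) auto
  then have "commut g x \<in> V" if "g \<in> N" for g using that by (auto simp: centr_def)
  then have "commut x g \<in> V" if "g \<in> N" for g using that commut_swap_mem[OF sV] xc Nc by blast
  then show False using x xc by (auto simp: centr_def)
qed

text \<open>Let \<open>x\<close> have maximal breadth modulo \<open>U\<close>. Then \<open>x\<close> has the same centralizer \<open>H\<close> modulo \<open>U\<close> and
  modulo \<open>V\<close>. For \<open>y\<close> in \<open>W\<close>, which is central modulo \<open>U\<close>, the same holds for \<open>x y\<close>. Hence \<open>H\<close> centralizes \<open>W\<close>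
  modulo \<open>V\<close>, while its index is governed by the breadth of \<open>x\<close>.\<close>
lemma ex_centralizing_admissible:
  assumes N: "admissible N" and V: "V \<lhd> G" and U: "U \<lhd> G" and W: "W \<lhd> G" and VU: "V \<subseteq> U"
    and c: "centralizes N W U" and Wc: "W \<subseteq> common" and eq: "max_breadth N V = max_breadth N U"
  obtains T where "admissible T" "T \<subseteq> N" "lg_card N \<le> lg_card T + max_breadth N V" "centralizes T W V"
proof -
  note sN = admissibleD(2)[OF N] and Nc = admissibleD(3)[OF N]
  note sV = normal_imp_subgroup[OF V] and sU = normal_imp_subgroup[OF U]
  note sC = normal_imp_subgroup[OF normal_C]
  obtain x where x: "x \<in> avoid N" "breadth N U x = max_breadth N U" using max_breadth_attained[OF N] .
  have xN: "x \<in> N" and xc: "x \<in> carrier G" using x Nc by (auto simp: avoid_def)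
  \<comment> \<open>The breadth of \<open>z\<close> modulo \<open>V\<close> is at most the common
    maximum, which \<open>z\<close> attains modulo \<open>U\<close>; so the smaller centralizer has
    no larger index than the bigger one.\<close>
  have same: "N \<inter> centr V {z} = N \<inter> centr U {z}"
    if z: "z \<in> avoid N" "breadth N U z = max_breadth N U" for z
  proof (rule lg_card_eqD)
    have zc: "z \<in> carrier G" using z Nc by (auto simp: avoid_def)
    show "subgroup (N \<inter> centr V {z}) G" "subgroup (N \<inter> centr U {z}) G"
      using sN V U zc by (auto intro: subgroup_Int_centr)
    show "N \<inter> centr V {z} \<subseteq> N \<inter> centr U {z}" using centr_mono[OF VU] by auto
    have "breadth N V z \<le> breadth N U z" using breadth_le_max_breadth[OF N z(1), of V] z(2) eq by simp
    then show "lg_card (N \<inter> centr U {z}) \<le> lg_card (N \<inter> centr V {z})"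
      using lg_card_Int_centr[OF sN V zc] lg_card_Int_centr[OF sN U zc] by linarith
  qed
  define T where "T = N \<inter> centr V (W \<inter> N)"
  have HT: "N \<inter> centr V {x} \<subseteq> T"
  proof
    fix g assume g: "g \<in> N \<inter> centr V {x}"
    then have gN: "g \<in> N" and gc: "g \<in> carrier G" and gx: "commut g x \<in> V" by (auto simp: centr_def)
    have "commut g y \<in> V" if y: "y \<in> W \<inter> N" for y
    proof -
      have yN: "y \<in> N" and yc: "y \<in> carrier G" using y Nc by auto
      have hy: "commut h y \<in> U" if "h \<in> N" for h
      proof -
        have "commut y h \<in> U" using c y that by (auto simp: centralizes_def)
        then show ?thesis using commut_swap_mem[OF sU yc] that Nc by auto
      qed
      \<comment> \<open>As \<open>y\<close> is central modulo \<open>U\<close>, the elements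
        \<open>x\<close> and \<open>x \<otimes> y\<close> have the same centralizer modulo
        \<open>U\<close>.\<close>
      have hU: "commut h (x \<otimes> y) \<in> U \<longleftrightarrow> commut h x \<in> U" if h: "h \<in> N" for h
      proof -
        have hc: "h \<in> carrier G" using h Nc by auto
        have k: "x \<otimes> commut h y \<otimes> inv x \<in> U" using hy[OF h] U xc by (intro normal_conjI)
        have "commut h (x \<otimes> y) = commut h x \<otimes> (x \<otimes> commut h y \<otimes> inv x)"
          using hc xc yc by (rule commut_mult_right)
        then show ?thesis
          using k sU hc xc yc
          by (metis commut_closed inv_closed inv_solve_right m_closed subgroup.m_closed subgroup.m_inv_closed)
      qed
      have xyN: "x \<otimes> y \<in> N" using sN xN yN by (rule subgroup.m_closed)
      have xyc: "x \<otimes> y \<in> carrier G" using xc yc by simp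
      \<comment> \<open>Here \<open>W \<subseteq> common\<close> enters: the factor \<open>y\<close>
        lies in every \<open>C i\<close>, while \<open>x\<close> lies in none.\<close>
      have "x \<otimes> y \<notin> C i" if i: "i \<in> I" for i
      proof
        assume "x \<otimes> y \<in> C i"
        moreover have "y \<in> C i" using y Wc i by (auto simp: common_def)
        ultimately have "x \<otimes> y \<otimes> inv y \<in> C i"
          using sC[OF i] by (simp add: subgroup.m_closed subgroup.m_inv_closed)
        then have "x \<in> C i" using xc yc by (simp add: m_assoc)
        then show False using x(1) i by (auto simp: avoid_def)
      qed
      then have xya: "x \<otimes> y \<in> avoid N" using xyN by (auto simp: avoid_def)
      have centrU: "N \<inter> centr U {x \<otimes> y} = N \<inter> centr U {x}" using hU by (auto simp: centr_def)
      then have "breadth N U (x \<otimes> y) = max_breadth N U" using x(2) by (simp add: breadth_def)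
      then have "N \<inter> centr V {x \<otimes> y} = N \<inter> centr V {x}" using same[OF xya] same[OF x] centrU by simp
      then have "commut g (x \<otimes> y) \<in> V" using g by (auto simp: centr_def)
      \<comment> \<open>As \<open>g\<close> centralizes both \<open>x\<close> and
        \<open>x \<otimes> y\<close> modulo \<open>V\<close>, cancelling and undoing the conjugation
        leaves \<open>commut g y\<close>.\<close>
      then have "commut g x \<otimes> (x \<otimes> commut g y \<otimes> inv x) \<in> V" using gc xc yc by (simp add: commut_mult_right)
      then have "inv (commut g x) \<otimes> (commut g x \<otimes> (x \<otimes> commut g y \<otimes> inv x)) \<in> V"
        using subgroup.m_closed[OF sV subgroup.m_inv_closed[OF sV gx]] by blast
      then have "x \<otimes> commut g y \<otimes> inv x \<in> V" using gc xc yc by simp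
      then have "inv x \<otimes> (x \<otimes> commut g y \<otimes> inv x) \<otimes> x \<in> V" using V xc by (intro normal_conjI')
      then show ?thesis using gc xc yc by (simp add: m_assoc)
    qed
    then show "g \<in> T" using gN gc by (auto simp: T_def centr_def)
  qed
  have nT: "T \<lhd> G"
    unfolding T_def using V W admissibleD(1)[OF N] by (intro normal_subgroup_intersect centr_normal)
  show ?thesis
  proof
    \<comment> \<open>Since \<open>x\<close> commutes with itself, it lies in \<open>T\<close>, so
      \<open>T\<close> is not covered by the \<open>C i\<close>.\<close>
    have "x \<in> N \<inter> centr V {x}" using xN xc sV by (simp add: centr_def subgroup.one_closed)
    then have "x \<in> avoid T" using HT x(1) by (auto simp: avoid_def)
    then show "admissible T" using nT by (auto simp: admissible_def)
    show "T \<subseteq> N" by (auto simp: T_def)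
    have "lg_card (N \<inter> centr V {x}) \<le> lg_card T"
      using HT normal_imp_subgroup[OF nT] sN V xc by (intro lg_card_mono subgroup_Int_centr)
    moreover have "breadth N V x \<le> max_breadth N V" using N x(1) by (rule breadth_le_max_breadth)
    ultimately show "lg_card N \<le> lg_card T + max_breadth N V" using lg_card_Int_centr[OF sN V xc] by linarith
    show "centralizes T W V" unfolding centralizes_def
    proof (intro ballI)
      fix w g assume w: "w \<in> W \<inter> T" and g: "g \<in> T"
      then have "commut g w \<in> V" by (auto simp: T_def centr_def)
      then show "commut w g \<in> V" using commut_swap_mem[OF sV, of g w] w g Nc by (auto simp: T_def)
    qed
  qed
qed

subsection \<open>Central chains\<close>

text \<open>In \<open>chain s N V r t\<close>, the bottom term is \<open>V\<close>, there are \<open>r\<close> further terms above it, and \<open>t\<close> is the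
  sum of the maximal breadths modulo the terms; the topmost one does not contribute, its maximal
  breadth being \<open>0\<close>. The flag \<open>s\<close> asks for strictly decreasing maximal breadths.
  The terms need not be contained in \<open>N\<close>, only their intersections with \<open>N\<close> matter.\<close>

inductive chain :: "bool \<Rightarrow> 'a set \<Rightarrow> 'a set \<Rightarrow> nat \<Rightarrow> nat \<Rightarrow> bool" for s N where
  base: "V \<lhd> G \<Longrightarrow> V \<subseteq> common \<Longrightarrow> (\<And>a b. a \<in> N \<Longrightarrow> b \<in> N \<Longrightarrow> commut a b \<in> V) \<Longrightarrow> chain s N V 0 0"
| step: "V \<lhd> G \<Longrightarrow> V \<subseteq> W \<Longrightarrow> centralizes N W V \<Longrightarrow> (s \<Longrightarrow> max_breadth N W < max_breadth N V) \<Longrightarrow>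
    chain s N W r t \<Longrightarrow> chain s N V (Suc r) (t + max_breadth N V)"

lemma chain_normal:
  assumes "chain s N V r t" shows "V \<lhd> G" "V \<subseteq> common"
  using assms by (induction) auto

text \<open>The terms are kept, but the maximal breadths may shrink by different amounts, so
  strictness is lost.\<close>

lemma chain_mono:
  assumes "chain s N V r t" "admissible M" "admissible N" "M \<subseteq> N"
  obtains t' where "t' \<le> t" "chain False M V r t'"
  using assms
proof (induction arbitrary: thesis rule: chain.induct)
  case (base V)
  then have "chain False M V 0 0" by (intro chain.base) auto
  then show ?case using base by blast
next
  case (step V W r t)
  obtain t' where t': "t' \<le> t" "chain False M W r t'" using step by blast
  have "chain False M V (Suc r) (t' + max_breadth M V)"
    using step t' centralizes_mono by (intro chain.step) auto
  moreover have "t' + max_breadth M V \<le> t + max_breadth N V"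
    using t' step max_breadth_mono by (intro add_mono) auto
  ultimately show ?case using step by blast
qed

text \<open>The maximal breadths are natural numbers that drop strictly \<open>r\<close>
  times.\<close>

lemma chain_length_le: "chain True N V r t \<Longrightarrow> r \<le> max_breadth N V"
proof (induction r arbitrary: V t)
  case (Suc r)
  from Suc.prems show ?case
  proof cases
    case (step W t0)
    then show ?thesis using Suc.IH[of W t0] by simp
  qed
qed simp

text \<open>Each step down the chain absorbs one commutator with \<open>N\<close>. The index is
  \<open>Suc r\<close> because \<open>lower_central\<close> counts from 0 and a chain with
  \<open>r = 0\<close> already absorbs one commutator.\<close>

lemma lower_central_chain:
  assumes N: "subgroup N G"
  shows "chain s N V r t \<Longrightarrow> lower_central G N (Suc r) \<subseteq> V \<inter> N"
proof (induction rule: chain.induct)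
  case (base V)
  note sV = normal_imp_subgroup[OF base(1)]
  have "generate G {a \<otimes> b \<otimes> inv a \<otimes> inv b | a b. a \<in> N \<and> b \<in> N} \<subseteq> V \<inter> N"
    using base(3) N sV unfolding commut_def
    by (intro generate_subgroup_incl subgroups_Inter_pair)
      (auto simp: subgroup.m_closed subgroup.m_inv_closed)
  then show ?case by simp
next
  case (step V W r t)
  note sV = normal_imp_subgroup[OF step(1)]
  have "generate G {a \<otimes> b \<otimes> inv a \<otimes> inv b | a b. a \<in> lower_central G N (Suc r) \<and> b \<in> N} \<subseteq> V \<inter> N"
  proof (intro generate_subgroup_incl subgroups_Inter_pair sV N subsetI)
    fix z assume "z \<in> {a \<otimes> b \<otimes> inv a \<otimes> inv b | a b. a \<in> lower_central G N (Suc r) \<and> b \<in> N}"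
    then obtain a b where z: "z = commut a b" "a \<in> W \<inter> N" "b \<in> N"
      using step.IH unfolding commut_def by blast
    have "commut a b \<in> V" using step(3) z by (auto simp: centralizes_def)
    moreover have "commut a b \<in> N"
      using z N by (auto simp: commut_def subgroup.m_closed subgroup.m_inv_closed)
    ultimately show "z \<in> V \<inter> N" using z by simp
  qed
  then show ?case by (simp only: lower_central.simps)
qed

section \<open>Shortening chains at repeated maximal breadths\<close>

lemma chain_drop:
  assumes "chain False N U r t" "admissible N" "max_breadth N U > 0"
  obtains U' W r' t' where "U' \<lhd> G" "U \<subseteq> U'" "U' \<subseteq> W" "max_breadth N U' = max_breadth N U" "centralizes N W U'"
    "max_breadth N W < max_breadth N U" "chain False N W r' t'"
  using assms
proof (induction arbitrary: thesis rule: chain.induct[consumes 1])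
  \<comment> \<open>The topmost term has maximal breadth 0, so a positive value must drop
    somewhere.\<close>
  case (base V)
  then show ?case using max_breadth_eq_0[OF base.prems(2) base.hyps(1)] by auto
next
  case (step V W r t)
  have W: "W \<lhd> G" using chain_normal[OF step.hyps(5)] by simp
  have le: "max_breadth N W \<le> max_breadth N V" using step W by (intro max_breadth_antimono) auto
  show ?case
  proof (cases "max_breadth N W < max_breadth N V")
    case True
    then show ?thesis using step by blast
  next
    \<comment> \<open>The value persists at \<open>W\<close>, so the last term with this value,
      \<open>U'\<close>, is found further up.\<close>
    case False
    then have eq: "max_breadth N W = max_breadth N V" using le by simp
    then obtain U' W' r' t' where *: "U' \<lhd> G" "W \<subseteq> U'" "U' \<subseteq> W'" "max_breadth N U' = max_breadth N W" "centralizes N W' U'"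
      "max_breadth N W' < max_breadth N W" "chain False N W' r' t'"
      using step.IH step.prems by (metis (no_types, lifting))
    then have "V \<subseteq> U'" using step.hyps by blast
    then show ?thesis using step.prems(1)[OF *(1) _ *(3) _ *(5) _ *(7)] * eq by auto
  qed
qed

text \<open>Induction on the bound \<open>b\<close> for the bottom breadth: collapsing the whole run
  of terms with the bottom value costs that value and leaves a tail of smaller breadth, so each
  value is paid and counted at most once.\<close>

lemma ex_short_chain:
  assumes "chain False N V r t" "admissible N" "max_breadth N V \<le> b"
  shows "\<exists>M r' t'. admissible M \<and> M \<subseteq> N \<and> chain False M V r' t' \<and> lg_card N \<le> lg_card M + \<Sum>{..b} \<and> t' \<le> \<Sum>{..b}"
  using assms
proof (induction b arbitrary: N V r t)
  case 0
  have V: "V \<lhd> G" "V \<subseteq> common" using chain_normal[OF 0(1)] by auto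
  have "chain False N V 0 0"
    using V commut_mem_if_max_breadth_eq_0[OF 0(2) V(1)] 0 by (intro chain.base) auto
  then show ?case using 0 by auto
next
  case (Suc b)
  have V: "V \<lhd> G" "V \<subseteq> common" using chain_normal[OF Suc.prems(1)] by auto
  show ?case
  proof (cases "max_breadth N V \<le> b")
    case True
    then obtain M r' t' where "admissible M" "M \<subseteq> N" "chain False M V r' t'" "lg_card N \<le> lg_card M + \<Sum>{..b}" "t' \<le> \<Sum>{..b}"
      using Suc by blast
    moreover have "\<Sum>{..b} \<le> \<Sum>{..Suc b}" by simp
    ultimately show ?thesis by (meson add_le_mono dual_order.trans le_refl)
  next
    case False
    then have b: "max_breadth N V = Suc b" using Suc.prems by simp
    then obtain U W r' t' where *: "U \<lhd> G" "V \<subseteq> U" "U \<subseteq> W" "max_breadth N U = max_breadth N V" "centralizes N W U"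
      "max_breadth N W < max_breadth N V" "chain False N W r' t'"
      using chain_drop[OF Suc.prems(1,2)] by (metis zero_less_Suc)
    have W: "W \<lhd> G" "W \<subseteq> common" using chain_normal[OF *(7)] by auto
    obtain T where T: "admissible T" "T \<subseteq> N" "lg_card N \<le> lg_card T + max_breadth N V" "centralizes T W V"
      using ex_centralizing_admissible[OF Suc.prems(2) V(1) *(1) W(1) *(2) *(5) W(2)] *(4) by metis
    obtain t1 where t1: "chain False T W r' t1" using chain_mono[OF *(7) T(1) Suc.prems(2) T(2)] by blast
    have "max_breadth T W \<le> max_breadth N W" using T Suc.prems W by (intro max_breadth_mono) auto
    then have "max_breadth T W \<le> b" using * b by simp
    then obtain M r2 t2 where M: "admissible M" "M \<subseteq> T" "chain False M W r2 t2" "lg_card T \<le> lg_card M + \<Sum>{..b}" "t2 \<le> \<Sum>{..b}"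
      using Suc.IH[OF t1 T(1)] by blast
    have "chain False M V (Suc r2) (t2 + max_breadth M V)"
      using V * M T centralizes_mono[OF T(4) M(2)] by (intro chain.step[where W = W]) auto
    moreover have "max_breadth M V \<le> max_breadth N V" using M T Suc.prems V by (intro max_breadth_mono) auto
    then have "t2 + max_breadth M V \<le> \<Sum>{..Suc b}" using M b by simp
    moreover have "lg_card N \<le> lg_card M + \<Sum>{..Suc b}" using M T b by simp
    ultimately show ?thesis using M T by blast
  qed
qed

text \<open>The last inequality says that the index of \<open>T\<close> in \<open>N\<close> is paid
  for by the decrease of the breadth sum. The tail is made strict first; a tie at the bottom is then
  collapsed, which shortens the chain.\<close>

lemma ex_strict_chain:
  assumes "chain False N V r t" "admissible N"
  shows "\<exists>T r' t'. admissible T \<and> T \<subseteq> N \<and> chain True T V r' t' \<and> r' \<le> r \<and> lg_card N + t' \<le> lg_card T + t"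
  using assms
proof (induction r arbitrary: N V t rule: less_induct)
  case (less r)
  note N = less.prems(2)
  from less.prems(1) show ?case
  proof cases
    case base
    then have "chain True N V 0 0" by (intro chain.base) auto
    then show ?thesis using base N by auto
  next
    case (step W r0 t0)
    have V: "V \<lhd> G" "V \<subseteq> common" using chain_normal[OF less.prems(1)] by auto
    have W: "W \<lhd> G" "W \<subseteq> common" using chain_normal[OF step(7)] by auto
    obtain T r1 t1 where T: "admissible T" "T \<subseteq> N" "chain True T W r1 t1" "r1 \<le> r0" "lg_card N + t1 \<le> lg_card T + t0"
      using less.IH[of r0 N W t0] step N by blast
    have bV: "max_breadth T V \<le> max_breadth N V" using T N V by (intro max_breadth_mono) auto
    have bW: "max_breadth T W \<le> max_breadth T V" using T V W step by (intro max_breadth_antimono) auto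
    have cTW: "centralizes T W V" using step T centralizes_mono by blast
    show ?thesis
    proof (cases "max_breadth T W < max_breadth T V")
      case True
      then have "chain True T V (Suc r1) (t1 + max_breadth T V)"
        using V step T cTW by (intro chain.step[where W = W]) auto
      moreover have "lg_card N + (t1 + max_breadth T V) \<le> lg_card T + t" using T bV step by simp
      ultimately show ?thesis using T step by blast
    next
      case False
      then have eq: "max_breadth T V = max_breadth T W" using bW by simp
      from T(3) show ?thesis
      proof cases
        case base
        \<comment> \<open>\<open>W\<close> is topmost, so the tie forces breadth 0 at
          \<open>V\<close> as well, and \<open>V\<close> alone forms a chain.\<close>
        then have "max_breadth T W = 0" using T by (intro max_breadth_eq_0) auto
        then have "chain True T V 0 0"
          using V T eq commut_mem_if_max_breadth_eq_0[OF T(1) V(1)] by (intro chain.base) auto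
        moreover have "lg_card N + 0 \<le> lg_card T + t" using T step by simp
        ultimately show ?thesis using T by blast
      next
        case W': (step W' r2 t2)
        have nW': "W' \<lhd> G" "W' \<subseteq> common" using chain_normal[OF W'(7)] by auto
        \<comment> \<open>The tie between \<open>V\<close> and \<open>W\<close> allows
          \<open>W\<close> to be skipped.\<close>
        obtain T' where T': "admissible T'" "T' \<subseteq> T" "lg_card T \<le> lg_card T' + max_breadth T V" "centralizes T' W' V"
          using ex_centralizing_admissible[OF T(1) V(1) W(1) nW'(1) step(4) W'(5) nW'(2) eq] by blast
        obtain t3 where t3: "t3 \<le> t2" "chain False T' W' r2 t3"
          using chain_mono[OF W'(7) T'(1) T(1) T'(2)] by blast
        have "chain False T' V (Suc r2) (t3 + max_breadth T' V)"
          using V step W' T' t3 by (intro chain.step[where W = W']) auto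
        moreover have "Suc r2 < r" using W' T step by simp
        ultimately obtain M r4 t4 where M: "admissible M" "M \<subseteq> T'" "chain True M V r4 t4" "r4 \<le> Suc r2"
          "lg_card T' + t4 \<le> lg_card M + (t3 + max_breadth T' V)"
          using less.IH T'(1) by blast
        have "max_breadth T' V \<le> max_breadth T V" using T T' V by (intro max_breadth_mono) auto
        \<comment> \<open>The cost \<open>max_breadth T V\<close> equals the summand
          \<open>max_breadth T W\<close> that left the sum together with \<open>W\<close>.\<close>
        then have "lg_card N + t4 \<le> lg_card M + t" using M T T' t3 step W' eq bV by simp
        moreover have "r4 \<le> r" using M \<open>Suc r2 < r\<close> by simp
        ultimately show ?thesis using M T' T by blast
      qed
    qed
  qed
qed

section \<open>Existence of a chain and the index bound\<close>

lemma common_normal: "common \<lhd> G"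
  unfolding normal_inv_iff
proof (intro conjI ballI)
  note sC = normal_imp_subgroup[OF normal_C]
  show "subgroup common G"
    by unfold_locales
      (auto simp: common_def subgroup.m_closed[OF sC] subgroup.one_closed[OF sC] subgroup.m_inv_closed[OF sC])
  show "g \<otimes> h \<otimes> inv g \<in> common" if "g \<in> carrier G" "h \<in> common" for g h
    using that by (auto simp: common_def normal_conjI[OF normal_C])
qed

text \<open>An upper central series of \<open>G\<close> above \<open>V\<close>, cut off at
  \<open>common\<close>; neither its length nor its breadth sum needs control, as
  \<open>ex_short_chain\<close> provides that.\<close>

lemma ex_chain:
  assumes "V \<lhd> G" "V \<subseteq> common"
  shows "\<exists>r t. chain False (carrier G) V r t"
  using assms
proof (induction "card common - card V" arbitrary: V rule: less_induct)
  case less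
  show ?case
  proof (cases "V = common")
    case True
    then have "chain False (carrier G) V 0 0"
      using less.prems commut_in_C by (intro chain.base) (auto simp: common_def)
    then show ?thesis by blast
  next
    case False
    note V = less.prems
    define W where "W = common \<inter> centr V (carrier G)"
    have W: "W \<lhd> G" "W \<subseteq> common"
      unfolding W_def using V common_normal normal_invI
      by (auto intro!: normal_subgroup_intersect normal_centr)
    have VW: "V \<subseteq> W"
      using V commut_in_normal_left[OF V(1)] by (auto simp: W_def centr_def common_def)
    \<comment> \<open>By \<open>ex_central_modulo\<close> the series grows strictly until it reaches
      \<open>common\<close>.\<close>
    have "\<exists>v\<in>common - V. \<forall>g\<in>carrier G. commut v g \<in> V"
      using V False common_normal by (intro ex_central_modulo) auto
    then have "V \<subset> W" using VW by (auto simp: W_def centr_def common_def)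
    moreover have fc: "finite common" using fin by (simp add: common_def)
    ultimately have "card V < card W" "card W \<le> card common"
      using W by (auto intro!: psubset_card_mono card_mono intro: finite_subset)
    then have "card common - card W < card common - card V" by simp
    then obtain r t where "chain False (carrier G) W r t" using less.hyps[OF _ W] by blast
    moreover have "centralizes (carrier G) W V" by (auto simp: centralizes_def W_def centr_def)
    ultimately have "chain False (carrier G) V (Suc r) (t + max_breadth (carrier G) V)"
      using V VW by (intro chain.step) auto
    then show ?thesis by blast
  qed
qed

theorem ex_normal_class_le:
  assumes n: "\<And>x. x \<in> avoid (carrier G) \<Longrightarrow> breadth (carrier G) {\<one>} x \<le> n"
  obtains N x where "N \<lhd> G" "x \<in> avoid N" "lg_card (carrier G) \<le> lg_card N + n * (n + 1)"
    "nilpotency_class G N \<le> 1 + breadth N {\<one>} x"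
proof -
  have one: "{\<one>} \<lhd> G" by (simp add: one_is_normal)
  have "\<exists>x\<in>carrier G. \<forall>i\<in>I. x \<notin> C i"
    using finite_I card_I normal_imp_subgroup[OF normal_C] C_proper
    by (intro not_covered subgroup_self) (auto simp: psubset_eq dest: subgroup.subset)
  then have G: "admissible (carrier G)" by (auto simp: admissible_def avoid_def normal_self)
  have "{\<one>} \<subseteq> common" using normal_imp_subgroup[OF common_normal] by (simp add: subgroup.one_closed)
  then obtain r t where "chain False (carrier G) {\<one>} r t" using ex_chain[OF one] by blast
  moreover obtain y where "y \<in> avoid (carrier G)" "breadth (carrier G) {\<one>} y = max_breadth (carrier G) {\<one>}"
    using max_breadth_attained[OF G] .
  then have "max_breadth (carrier G) {\<one>} \<le> n" using n by metis
  ultimately obtain M r' t' where M: "admissible M" "chain False M {\<one>} r' t'" "lg_card (carrier G) \<le> lg_card M + \<Sum>{..n}" "t' \<le> \<Sum>{..n}"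
    using ex_short_chain G by blast
  obtain T s u where T: "admissible T" "chain True T {\<one>} s u" "lg_card M + u \<le> lg_card T + t'"
    using ex_strict_chain[OF M(2,1)] by blast
  obtain x where x: "x \<in> avoid T" "breadth T {\<one>} x = max_breadth T {\<one>}" using max_breadth_attained[OF T(1)] .
  \<comment> \<open>Passing from \<open>G\<close> to \<open>M\<close> costs at most
    \<open>\<Sum>{..n}\<close>, and passing from \<open>M\<close> to \<open>T\<close> at most
    \<open>t'\<close>, which has the same bound.\<close>
  have "\<Sum>{..n} * 2 = n * (n + 1)" by (induction n) auto
  then have lg_card: "lg_card (carrier G) \<le> lg_card T + n * (n + 1)" using M T by simp
  have "lower_central G T (Suc s) \<subseteq> {\<one>}" using lower_central_chain[OF admissibleD(2)[OF T(1)] T(2)] by blast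
  then have "lower_central G T (Suc s) = {\<one>}" using generate.one[of G] by auto
  then have "nilpotency_class G T \<le> Suc s" unfolding nilpotency_class_def by (rule Least_le)
  also have "\<dots> \<le> 1 + breadth T {\<one>} x" using chain_length_le[OF T(2)] x by simp
  finally show ?thesis using that[OF admissibleD(1)[OF T(1)] x(1) lg_card] by blast
qed

end

theorem theorem3:
  fixes G :: "('a, 'b) monoid_scheme" and p n :: nat and C :: "nat \<Rightarrow> 'a set"
  assumes "Factorial_Ring.prime p" and "p > 2"
    and "group G" and "finite (carrier G)" and "\<exists>k. card (carrier G) = p ^ k"
    and "\<And>i. i \<in> {1..p-1} \<Longrightarrow> C i \<lhd> G"
    and "\<And>i. i \<in> {1..p-1} \<Longrightarrow> C i \<noteq> carrier G"
    and "\<forall>g \<in> carrier G - (\<Union>i\<in>{1..p-1}. C i). bdeg G p g \<le> real n"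
  shows "\<exists>N. N \<lhd> G
    \<and> log (real p) (real (card (carrier G)) / real (card N)) \<le> real (n * (n + 2))
    \<and> \<not> N \<subseteq> (\<Union>i\<in>{1..p-1}. C i)
    \<and> real (nilpotency_class G N)
        \<le> 1 + Max ((\<lambda>g. bdeg_sub G p N g) ` (N - (\<Union>i\<in>{1..p-1}. C i)))"
proof -
  interpret group G by (rule assms(3))
  interpret finite_p_group G p by unfold_locales (rule assms(1,4,5))+
  \<comment> \<open>Each \<open>C i\<close> is enlarged to a proper normal \<open>M i\<close> with
    abelian quotient; elements avoiding all \<open>M i\<close> avoid all \<open>C i\<close>
    too.\<close>
  have "\<exists>M. M \<lhd> G \<and> M \<noteq> carrier G \<and> C i \<subseteq> M \<and> (\<forall>a\<in>carrier G. \<forall>b\<in>carrier G. commut a b \<in> M)"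
    if "i \<in> {1..p-1}" for i
    using assms(6)[OF that] assms(7)[OF that] by (rule ex_normal_commut)
  then obtain M where M: "\<And>i. i \<in> {1..p-1} \<Longrightarrow> M i \<lhd> G"
      "\<And>i. i \<in> {1..p-1} \<Longrightarrow> M i \<noteq> carrier G"
      "\<And>i. i \<in> {1..p-1} \<Longrightarrow> C i \<subseteq> M i"
      "\<And>i a b. i \<in> {1..p-1} \<Longrightarrow> a \<in> carrier G \<Longrightarrow> b \<in> carrier G \<Longrightarrow> commut a b \<in> M i"
    by metis
  interpret p_group_avoiding G p "{1..p-1}" M
    by (intro p_group_avoiding.intro finite_p_group_axioms p_group_avoiding_axioms.intro)
      (use M p_gt_1 in simp_all)
  have CM: "(\<Union>i\<in>{1..p-1}. C i) \<subseteq> (\<Union>i\<in>{1..p-1}. M i)" using M by blast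
  have "breadth (carrier G) {\<one>\<^bsub>G\<^esub>} x \<le> n" if x: "x \<in> avoid (carrier G)" for x
  proof -
    have xa: "x \<in> carrier G - (\<Union>i\<in>{1..p-1}. C i)" using x CM unfolding avoid_def by blast
    then have xc: "x \<in> carrier G" by blast
    have "bdeg G p x = bdeg_sub G p (carrier G) x"
      by (simp add: bdeg_def bdeg_sub_def centralizer_def Int_def conj_ac)
    then have "bdeg G p x = real (breadth (carrier G) {\<one>\<^bsub>G\<^esub>} x)"
      using xc by (simp add: bdeg_sub_eq_breadth subgroup_self)
    moreover have "bdeg G p x \<le> real n" using assms(8) xa by blast
    ultimately show ?thesis by simp
  qed
  then obtain N x where N: "N \<lhd> G" and x: "x \<in> avoid N"
    and lgN: "lg_card (carrier G) \<le> lg_card N + n * (n + 1)"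
    and cl: "nilpotency_class G N \<le> 1 + breadth N {\<one>\<^bsub>G\<^esub>} x"
    using ex_normal_class_le by blast
  note sN = normal_imp_subgroup[OF N]
  have xN: "x \<in> N - (\<Union>i\<in>{1..p-1}. C i)" using x CM unfolding avoid_def by blast
  show ?thesis
  proof (intro exI conjI)
    show "N \<lhd> G" by (rule N)
    show "\<not> N \<subseteq> (\<Union>i\<in>{1..p-1}. C i)" using xN by blast
    have "log (real p) (real (card (carrier G)) / real (card N)) = real (lg_card (carrier G)) - real (lg_card N)"
      using p_gt_1 sN by (simp add: card_subgroup subgroup_self log_divide log_nat_power)
    also have "\<dots> \<le> real (n * (n + 1))" using lgN by linarith
    also have "\<dots> \<le> real (n * (n + 2))" by simp
    finally show "log (real p) (real (card (carrier G)) / real (card N)) \<le> real (n * (n + 2))" .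
    have "real (nilpotency_class G N) \<le> 1 + bdeg_sub G p N x"
      using cl xN by (simp add: bdeg_sub_eq_breadth[OF sN] subgroup.mem_carrier[OF sN])
    \<comment> \<open>\<open>x\<close> attains the maximum outside the \<open>M i\<close>, hence
      bounds from below the maximum over the larger set outside the \<open>C i\<close>.\<close>
    also have "bdeg_sub G p N x \<le> Max ((\<lambda>g. bdeg_sub G p N g) ` (N - (\<Union>i\<in>{1..p-1}. C i)))"
      using xN finite_subgroup[OF sN] by (intro Max_ge) auto
    finally show "real (nilpotency_class G N)
        \<le> 1 + Max ((\<lambda>g. bdeg_sub G p N g) ` (N - (\<Union>i\<in>{1..p-1}. C i)))" by simp
  qed
qed

end
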